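(* Let $\lambda>0$, $x^c\in\mathbb{R}^n$, let $B\subset\mathrm{dom}\,h$ be a nonempty finite set, let $\Gamma=\Gamma(\cdot;B)$, and let $x=\mathrm{argmin}_{u\in\mathbb{R}^n}\{\Gamma(u)+\frac1{2\lambda}\|u-x^c\|^2\}$. Set $$B(x):=\{b\in B:\ell_f(x;b)+h(x)=\Gamma(x)\},$$ let $B^+$ be any set with $B(x)\cup\{x\}\subset B^+\subset B\cup\{x\}$, and set $\Gamma^+:=\Gamma(\cdot;B^+)$ and $\bar\Gamma:=\Gamma(\cdot;B(x))$. Then, for any $\tau\in(0,1)$, $$\Gamma^+\in\overline{\mathrm{Conv}}_\mu(\mathbb{R}^n),\qquad\tau\bar\Gamma+(1-\tau)[\ell_f(\cdot;x)+h]\le\Gamma^+\le\phi,$$ and $$\bar\Gamma\in\overline{\mathrm{Conv}}_\mu(\mathbb{R}^n),\qquad\bar\Gamma(x)=\Gamma(x),\qquad x=\underset{u\in\mathbb{R}^n}{\mathrm{argmin}}\left\{\bar\Gamma(u)+\frac1{2\lambda}\|u-x^c\|^2\right\}.$$ As a consequence, $\Gamma^+$ (the multiple-cuts update (E3)) is a special implementation of the bundle update blackbox BU.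
   Context: For $\mu\ge0$, $\overline{\mathrm{Conv}}_\mu(\mathbb{R}^n)$ is the set of proper lower semicontinuous functions $\Psi:\mathbb{R}^n\to(-\infty,+\infty]$ such that $\Psi-\mu\|\cdot\|^2/2$ is convex. Standing assumptions: $f$ is proper lower semicontinuous convex on $\mathbb{R}^n$, $h\in\overline{\mathrm{Conv}}_\mu(\mathbb{R}^n)$, $\mathrm{dom}\,h\subset\mathrm{dom}\,f$, $\phi=f+h$, and $f':\mathrm{dom}\,h\to\mathbb{R}^n$ satisfies $f'(z)\in\partial f(z)$ for every $z\in\mathrm{dom}\,h$. $\ell_f(u;z)=f(z)+\langle f'(z),u-z\rangle$ for $z\in\mathrm{dom}\,h$. For a nonempty finite set $B\subset\mathrm{dom}\,h$, $\Gamma(\cdot;B):=\max\{\ell_f(\cdot;b):b\in B\}+h$. BU blackbox: given $(\lambda,\tau)\in(0,\infty)\times(0,1)$ and $(x^c,x,\Gamma)\in\mathbb{R}^n\times\mathbb{R}^n\times\overline{\mathrm{Conv}}_\mu(\mathbb{R}^n)$ with $\Gamma\le\phi$ and $x=\mathrm{argmin}_u\{\Gamma(u)+\frac1{2\lambda}\|u-x^c\|^2\}$, it outputs any $\Gamma^+\in\overline{\mathrm{Conv}}_\mu(\mathbb{R}^n)$ such that $\tau\bar\Gamma+(1-\tau)[\ell_f(\cdot;x)+h]\le\Gamma^+\le\phi$ for some $\bar\Gamma\in\overline{\mathrm{Conv}}_\mu(\mathbb{R}^n)$ with $\bar\Gamma(x)=\Gamma(x)$ and $x=\mathrm{argmin}_u\{\bar\Gamma(u)+\frac1{2\lambda}\|u-x^c\|^2\}$.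 *)

theory Defs
  imports "HOL-Analysis.Analysis"
begin

text \<open>
  A function from \<open>\<real>\<^sup>n\<close> to \<open>(-\<infinity>, +\<infinity>]\<close> is a function \<open>real ^ 'n \<Rightarrow> ereal\<close> that never
  takes the value \<open>-\<infinity>\<close>; this last requirement is part of \<open>proper\<close>.
\<close>

definition edom :: "('a \<Rightarrow> ereal) \<Rightarrow> 'a set" where
  "edom g = {x. g x < \<infinity>}"

definition proper :: "('a \<Rightarrow> ereal) \<Rightarrow> bool" where
  "proper g \<longleftrightarrow> (\<forall>x. g x \<noteq> -\<infinity>) \<and> edom g \<noteq> {}"

definition lsc :: "('a::topological_space \<Rightarrow> ereal) \<Rightarrow> bool" where
  "lsc g \<longleftrightarrow> (\<forall>x. g x \<le> Liminf (at x) g)"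

text \<open>Only meant for functions that avoid \<open>-\<infinity>\<close>, where no sum \<open>\<infinity> + -\<infinity>\<close> can arise.\<close>

definition econvex :: "('a::real_vector \<Rightarrow> ereal) \<Rightarrow> bool" where
  "econvex g \<longleftrightarrow> (\<forall>x y. \<forall>t\<in>{0<..<1}.
     g ((1 - t) *\<^sub>R x + t *\<^sub>R y) \<le> ereal (1 - t) * g x + ereal t * g y)"

definition Conv :: "real \<Rightarrow> (real ^ 'n \<Rightarrow> ereal) set" where
  "Conv \<mu> = {\<Psi>. proper \<Psi> \<and> lsc \<Psi> \<and> econvex (\<lambda>u. \<Psi> u - ereal (\<mu> * (norm u)\<^sup>2 / 2))}"

definition subdifferential :: "(real ^ 'n \<Rightarrow> ereal) \<Rightarrow> real ^ 'n \<Rightarrow> (real ^ 'n) set" where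
  "subdifferential g z = {s. \<forall>u. g z + ereal (s \<bullet> (u - z)) \<le> g u}"

text \<open>
  The set of all global minimizers. The usage \<open>x = argmin g\<close> (\<open>x\<close> is the minimizer of \<open>g\<close>)
  is rendered as \<open>argmin g = {x}\<close>.
\<close>

definition argmin :: "('a \<Rightarrow> ereal) \<Rightarrow> 'a set" where
  "argmin g = {x. is_arg_min g (\<lambda>_. True) x}"

definition prox_objective ::
  "real \<Rightarrow> real ^ 'n \<Rightarrow> (real ^ 'n \<Rightarrow> ereal) \<Rightarrow> real ^ 'n \<Rightarrow> ereal" where
  "prox_objective lam xc g u = g u + ereal (1 / (2 * lam) * (norm (u - xc))\<^sup>2)"

text \<open>
  \<open>linearization f f' u z\<close> is \<open>\<ell>\<^sub>f(u; z)\<close>. The selection \<open>f'\<close> is a total function here, but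
  only its values on \<open>edom h\<close> are constrained and meaningful.
\<close>

definition linearization ::
  "(real ^ 'n \<Rightarrow> ereal) \<Rightarrow> (real ^ 'n \<Rightarrow> real ^ 'n) \<Rightarrow> real ^ 'n \<Rightarrow> real ^ 'n \<Rightarrow> ereal" where
  "linearization f f' u z = f z + ereal (f' z \<bullet> (u - z))"

text \<open>Only meant for nonempty finite \<open>B \<subseteq> edom h\<close>.\<close>

definition cut_model ::
  "(real ^ 'n \<Rightarrow> ereal) \<Rightarrow> (real ^ 'n \<Rightarrow> real ^ 'n) \<Rightarrow> (real ^ 'n \<Rightarrow> ereal)
    \<Rightarrow> (real ^ 'n) set \<Rightarrow> real ^ 'n \<Rightarrow> ereal" where
  "cut_model f f' h B u = Max ((\<lambda>b. linearization f f' u b) ` B) + h u"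

text \<open>
  The blackbox BU, with \<open>\<phi> = f + h\<close>, is given by its admissible inputs and, for each of them,
  its admissible outputs.
\<close>

definition BU_input ::
  "real \<Rightarrow> (real ^ 'n \<Rightarrow> ereal) \<Rightarrow> (real ^ 'n \<Rightarrow> ereal) \<Rightarrow> real \<Rightarrow> real
    \<Rightarrow> real ^ 'n \<Rightarrow> real ^ 'n \<Rightarrow> (real ^ 'n \<Rightarrow> ereal) \<Rightarrow> bool" where
  "BU_input \<mu> f h lam \<tau> xc x \<Gamma> \<longleftrightarrow>
     0 < lam \<and> 0 < \<tau> \<and> \<tau> < 1 \<and> \<Gamma> \<in> Conv \<mu> \<and>
     (\<forall>u. \<Gamma> u \<le> f u + h u) \<and>
     argmin (prox_objective lam xc \<Gamma>) = {x}"

text \<open>The conjunct \<open>x \<in> edom h\<close> makes explicit what \<open>\<ell>\<^sub>f(\<cdot>; x)\<close> needs in order to be defined.\<close>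

definition BU_output ::
  "real \<Rightarrow> (real ^ 'n \<Rightarrow> ereal) \<Rightarrow> (real ^ 'n \<Rightarrow> real ^ 'n) \<Rightarrow> (real ^ 'n \<Rightarrow> ereal)
    \<Rightarrow> real \<Rightarrow> real \<Rightarrow> real ^ 'n \<Rightarrow> real ^ 'n \<Rightarrow> (real ^ 'n \<Rightarrow> ereal)
    \<Rightarrow> (real ^ 'n \<Rightarrow> ereal) \<Rightarrow> bool" where
  "BU_output \<mu> f f' h lam \<tau> xc x \<Gamma> \<Gamma>p \<longleftrightarrow>
     x \<in> edom h \<and> \<Gamma>p \<in> Conv \<mu> \<and>
     (\<exists>\<Gamma>b \<in> Conv \<mu>.
        \<Gamma>b x = \<Gamma> x \<and>
        argmin (prox_objective lam xc \<Gamma>b) = {x} \<and>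
        (\<forall>u. ereal \<tau> * \<Gamma>b u + ereal (1 - \<tau>) * (linearization f f' u x + h u) \<le> \<Gamma>p u \<and>
             \<Gamma>p u \<le> f u + h u))"

end

theory Submission
  imports Defs
begin

text \<open>
  On \<open>edom h\<close> the function \<open>f\<close> is finite, so a cut model \<open>\<Gamma>(\<cdot>; B)\<close> is \<open>h\<close> plus a finite maximum of real
  affine functions.  Such a maximum is convex and continuous, and adding a function of this kind to
  a member of \<open>Conv \<mu>\<close> stays inside \<open>Conv \<mu>\<close> (\<open>Conv_add_real\<close>); this settles all memberships in \<open>Conv \<mu>\<close>.
  The bounds on \<open>\<Gamma>\<^sup>+\<close> hold because every cut lies below \<open>f\<close>, and because \<open>B\<^sup>+\<close> contains both
  \<open>B(x)\<close> and \<open>x\<close>: the two members of the convex combination lie below \<open>\<Gamma>\<^sup>+\<close> separately.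

  The one point with content is that dropping the cuts that are inactive at \<open>x\<close> keeps the minimizer
  of the proximal problem.  Inactive cuts are strictly below the maximum at \<open>x\<close>, hence by continuity
  near \<open>x\<close>, so the two models coincide on a neighbourhood of \<open>x\<close> (\<open>eventually_Max_active\<close>).  The
  proximal objective of the smaller model is convex, so a point other than \<open>x\<close> doing at least as well
  as \<open>x\<close> would keep the values on the segment towards \<open>x\<close> that low all the way into this neighbourhood,
  against the uniqueness of the minimizer of the original problem (\<open>argmin_eq_of_local_agreement\<close>).
\<close>

section \<open>Finite maxima of real functions\<close>

lemma convex_on_Max:
  fixes l :: "'i \<Rightarrow> 'a::real_vector \<Rightarrow> real"
  assumes "finite B" "B \<noteq> {}" "\<And>b. b \<in> B \<Longrightarrow> convex_on UNIV (l b)"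
  shows "convex_on UNIV (\<lambda>u. Max ((\<lambda>b. l b u) ` B))"
proof (rule convex_onI)
  fix t :: real and x y :: 'a
  assume t: "0 < t" "t < 1"
  let ?M = "\<lambda>u. Max ((\<lambda>b. l b u) ` B)"
  have "l b ((1 - t) *\<^sub>R x + t *\<^sub>R y) \<le> (1 - t) * ?M x + t * ?M y" if "b \<in> B" for b
  proof -
    have "l b ((1 - t) *\<^sub>R x + t *\<^sub>R y) \<le> (1 - t) * l b x + t * l b y"
      using convex_onD[OF assms(3)[OF that]] t by simp
    also have "\<dots> \<le> (1 - t) * ?M x + t * ?M y"
      using t that assms(1) by (intro add_mono mult_left_mono Max_ge) auto
    finally show ?thesis .
  qed
  then show "?M ((1 - t) *\<^sub>R x + t *\<^sub>R y) \<le> (1 - t) * ?M x + t * ?M y"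
    using assms(1,2) by simp
qed simp

lemma continuous_on_Max:
  fixes l :: "'i \<Rightarrow> 'a::topological_space \<Rightarrow> real"
  assumes "finite B" "B \<noteq> {}" "\<And>b. b \<in> B \<Longrightarrow> continuous_on S (l b)"
  shows "continuous_on S (\<lambda>u. Max ((\<lambda>b. l b u) ` B))"
  using assms
proof (induction B rule: finite_ne_induct)
  case (insert b B)
  then have "continuous_on S (\<lambda>u. max (l b u) (Max ((\<lambda>b. l b u) ` B)))"
    by (intro continuous_on_max) auto
  then show ?case
    using insert.hyps by simp
qed simp

text \<open>Near \<open>x\<close> only the pieces attaining the maximum at \<open>x\<close> matter: each of the finitely many others
  stays strictly below any fixed active piece on a neighbourhood of \<open>x\<close>.\<close>

lemma eventually_Max_active:
  fixes l :: "'i \<Rightarrow> 'a::topological_space \<Rightarrow> real"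
  assumes fin: "finite B" and ne: "B \<noteq> {}"
    and cont: "\<And>b. b \<in> B \<Longrightarrow> continuous_on UNIV (l b)"
    and A: "A = {b \<in> B. l b x = Max ((\<lambda>b. l b x) ` B)}"
  shows "\<forall>\<^sub>F u in nhds x. Max ((\<lambda>b. l b u) ` A) = Max ((\<lambda>b. l b u) ` B)"
proof -
  have "Max ((\<lambda>b. l b x) ` B) \<in> (\<lambda>b. l b x) ` B"
    using fin ne by simp
  then obtain a where a: "a \<in> A" "a \<in> B"
    using A by auto
  have tend: "(l b \<longlongrightarrow> l b x) (nhds x)" if "b \<in> B" for b
    using cont[OF that]
    by (simp add: continuous_on_def tendsto_at_iff_tendsto_nhds)
  have "\<forall>\<^sub>F u in nhds x. l b u < l a u" if b: "b \<in> B - A" for b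
  proof -
    have "l b x \<le> Max ((\<lambda>b. l b x) ` B)"
      using fin b by auto
    then have "l b x < l a x"
      using a b A by auto
    then have "0 < l a x - l b x"
      by simp
    moreover have "((\<lambda>u. l a u - l b u) \<longlongrightarrow> l a x - l b x) (nhds x)"
      using tend a b by (intro tendsto_diff) auto
    ultimately have "\<forall>\<^sub>F u in nhds x. 0 < l a u - l b u"
      by (rule order_tendstoD(1)[rotated])
    then show ?thesis
      by simp
  qed
  then have "\<forall>\<^sub>F u in nhds x. \<forall>b\<in>B - A. l b u < l a u"
    using fin by (intro eventually_ball_finite) auto
  then show ?thesis
  proof eventually_elim
    case (elim u)
    have fA: "finite A" "A \<subseteq> B" "A \<noteq> {}"
      using fin a A by auto
    have "l b u \<le> Max ((\<lambda>b. l b u) ` A)" if "b \<in> B" for b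
    proof (cases "b \<in> A")
      case False
      then have "l b u \<le> l a u"
        using elim that by (simp add: less_imp_le)
      also have "\<dots> \<le> Max ((\<lambda>b. l b u) ` A)"
        using fA a by auto
      finally show ?thesis .
    qed (use fA in auto)
    then have "Max ((\<lambda>b. l b u) ` B) \<le> Max ((\<lambda>b. l b u) ` A)"
      using fin ne by simp
    moreover have "Max ((\<lambda>b. l b u) ` A) \<le> Max ((\<lambda>b. l b u) ` B)"
      using fA fin by (intro Max_mono) auto
    ultimately show ?case
      by simp
  qed
qed

section \<open>Extended-valued convex functions\<close>

lemma convex_on_norm_squared: "convex_on UNIV (\<lambda>u::'a::real_inner. (norm (u - c))\<^sup>2)"
proof (rule convex_onI)
  fix t :: real and x y :: 'a
  assume t: "0 < t" "t < 1"
  have "(1 - t) * (norm (x - c))\<^sup>2 + t * (norm (y - c))\<^sup>2 -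
      (norm ((1 - t) *\<^sub>R x + t *\<^sub>R y - c))\<^sup>2 = t * (1 - t) * (norm (x - y))\<^sup>2"
    unfolding power2_norm_eq_inner
    by (simp add: inner_diff inner_add inner_commute algebra_simps)
  moreover have "0 \<le> t * (1 - t) * (norm (x - y))\<^sup>2"
    using t by simp
  ultimately show "(norm ((1 - t) *\<^sub>R x + t *\<^sub>R y - c))\<^sup>2 \<le>
      (1 - t) * (norm (x - c))\<^sup>2 + t * (norm (y - c))\<^sup>2"
    by linarith
qed simp

lemma econvex_add_real:
  assumes \<psi>: "econvex \<psi>" and g: "convex_on UNIV g"
  shows "econvex (\<lambda>u. \<psi> u + ereal (g u))"
  unfolding econvex_def
proof (intro allI ballI)
  fix x y :: 'a and t :: real
  assume "t \<in> {0<..<1}"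
  then have t: "0 < t" "t < 1"
    by auto
  have "\<psi> ((1 - t) *\<^sub>R x + t *\<^sub>R y) + ereal (g ((1 - t) *\<^sub>R x + t *\<^sub>R y)) \<le>
      (ereal (1 - t) * \<psi> x + ereal t * \<psi> y) + ereal ((1 - t) * g x + t * g y)"
    using \<psi> t convex_onD[OF g, of t x y] unfolding econvex_def by (intro add_mono) auto
  also have "\<dots> = ereal (1 - t) * (\<psi> x + ereal (g x)) + ereal t * (\<psi> y + ereal (g y))"
    using t by (cases "\<psi> x"; cases "\<psi> y") (simp_all add: algebra_simps)
  finally show "\<psi> ((1 - t) *\<^sub>R x + t *\<^sub>R y) + ereal (g ((1 - t) *\<^sub>R x + t *\<^sub>R y)) \<le>
      ereal (1 - t) * (\<psi> x + ereal (g x)) + ereal t * (\<psi> y + ereal (g y))" .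
qed

text \<open>A bound \<open>y < g x + h x\<close> is split by a real \<open>z\<close> into \<open>y - z < g x\<close> and \<open>z < h x\<close>, each of which persists
  near \<open>x\<close>; this also covers the points where \<open>h\<close> is infinite.\<close>

lemma lsc_real_add:
  fixes h :: "'a::perfect_space \<Rightarrow> ereal"
  assumes g: "continuous_on UNIV g" and h: "lsc h"
  shows "lsc (\<lambda>u. ereal (g u) + h u)"
  unfolding lsc_def le_Liminf_iff
proof (intro allI impI)
  fix x y
  assume y: "y < ereal (g x) + h x"
  then have "y - ereal (g x) < h x"
    by (cases y; cases "h x") auto
  then obtain z where z: "y - ereal (g x) < ereal z" "ereal z < h x"
    using ereal_dense2 by blast
  have hz: "\<forall>\<^sub>F u in at x. ereal z < h u"
    using h z(2) unfolding lsc_def le_Liminf_iff by blast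
  show "\<forall>\<^sub>F u in at x. y < ereal (g u) + h u"
  proof (cases y)
    case (real r)
    have "(g \<longlongrightarrow> g x) (at x)"
      using g by (simp add: continuous_on_def)
    moreover have "r - z < g x"
      using z(1) real by simp
    ultimately have "\<forall>\<^sub>F u in at x. r - z < g u"
      by (rule order_tendstoD(1))
    with hz show ?thesis
    proof eventually_elim
      case (elim u)
      then show ?case
        using real by (cases "h u") auto
    qed
  next
    case PInf
    then show ?thesis
      using y by simp
  next
    case MInf
    show ?thesis
      using hz by eventually_elim (use MInf in \<open>auto simp: less_ereal.simps\<close>)
  qed
qed

lemma Conv_add_real:
  assumes h: "h \<in> Conv \<mu>" and g: "convex_on UNIV g" "continuous_on UNIV g"
  shows "(\<lambda>u. ereal (g u) + h u) \<in> Conv \<mu>"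
proof -
  have "econvex (\<lambda>u. (h u - ereal (\<mu> * (norm u)\<^sup>2 / 2)) + ereal (g u))"
    using h g(1) by (intro econvex_add_real) (auto simp: Conv_def)
  also have "(\<lambda>u. (h u - ereal (\<mu> * (norm u)\<^sup>2 / 2)) + ereal (g u)) =
      (\<lambda>u. (ereal (g u) + h u) - ereal (\<mu> * (norm u)\<^sup>2 / 2))"
  proof
    fix u
    show "(h u - ereal (\<mu> * (norm u)\<^sup>2 / 2)) + ereal (g u) =
        (ereal (g u) + h u) - ereal (\<mu> * (norm u)\<^sup>2 / 2)"
      by (cases "h u") auto
  qed
  finally have "econvex (\<lambda>u. (ereal (g u) + h u) - ereal (\<mu> * (norm u)\<^sup>2 / 2))" .
  moreover have "proper (\<lambda>u. ereal (g u) + h u)"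
    using h by (auto simp: Conv_def proper_def edom_def)
  ultimately show ?thesis
    using lsc_real_add[OF g(2)] h by (auto simp: Conv_def)
qed

text \<open>The quadratic \<open>\<mu>\<parallel>u\<parallel>\<^sup>2 / 2\<close> subtracted in the definition of \<open>Conv\<close> is convex because \<open>\<mu> \<ge> 0\<close>, so it may be
  added back together with the proximal term.\<close>

lemma econvex_prox_objective:
  assumes "0 \<le> \<mu>" "0 < lam" and \<Psi>: "\<Psi> \<in> Conv \<mu>"
  shows "econvex (prox_objective lam xc \<Psi>)"
proof -
  let ?q = "\<lambda>u. \<mu> / 2 * (norm (u - 0))\<^sup>2" and ?p = "\<lambda>u. 1 / (2 * lam) * (norm (u - xc))\<^sup>2"
  have "convex_on UNIV (\<lambda>u. ?q u + ?p u)"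
    using assms(1,2) by (intro convex_on_add convex_on_cmul convex_on_norm_squared) auto
  then have "econvex (\<lambda>u. (\<Psi> u - ereal (\<mu> * (norm u)\<^sup>2 / 2)) + ereal (?q u + ?p u))"
    using \<Psi> by (intro econvex_add_real) (auto simp: Conv_def)
  also have "(\<lambda>u. (\<Psi> u - ereal (\<mu> * (norm u)\<^sup>2 / 2)) + ereal (?q u + ?p u)) =
      prox_objective lam xc \<Psi>"
  proof
    fix u
    show "(\<Psi> u - ereal (\<mu> * (norm u)\<^sup>2 / 2)) + ereal (?q u + ?p u) = prox_objective lam xc \<Psi> u"
      by (cases "\<Psi> u") (auto simp: prox_objective_def)
  qed
  finally show ?thesis .
qed

lemma argmin_iff: "x \<in> argmin P \<longleftrightarrow> (\<forall>u. P x \<le> P u)"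
  for P :: "'a \<Rightarrow> ereal"
  by (simp add: argmin_def is_arg_min_linorder)

text \<open>A point \<open>u \<noteq> x\<close> doing at least as well as \<open>x\<close> for the convex function \<open>Q\<close> would make all points of the
  segment from \<open>x\<close> to \<open>u\<close> do so; those close to \<open>x\<close> would be further minimizers of \<open>P\<close>.\<close>

lemma argmin_eq_of_local_agreement:
  fixes P Q :: "'a::real_normed_vector \<Rightarrow> ereal"
  assumes P: "argmin P = {x}" and fin: "\<bar>P x\<bar> \<noteq> \<infinity>"
    and Q: "econvex Q" and agree: "\<forall>\<^sub>F u in nhds x. Q u = P u"
  shows "argmin Q = {x}"
proof -
  have Qx: "Q x = P x"
    using eventually_nhds_x_imp_x[OF agree] .
  have less: "Q x < Q u" if "u \<noteq> x" for u
  proof (rule ccontr)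
    assume "\<not> Q x < Q u"
    then have le: "Q u \<le> P x"
      using Qx by simp
    have "((\<lambda>t. (1 - t) *\<^sub>R x + t *\<^sub>R u) \<longlongrightarrow> (1 - 0) *\<^sub>R x + 0 *\<^sub>R u) (at_right 0)"
      by (intro tendsto_intros)
    then have "filterlim (\<lambda>t. (1 - t) *\<^sub>R x + t *\<^sub>R u) (nhds x) (at_right (0::real))"
      by simp
    then have "\<forall>\<^sub>F t in at_right (0::real).
        Q ((1 - t) *\<^sub>R x + t *\<^sub>R u) = P ((1 - t) *\<^sub>R x + t *\<^sub>R u)"
      using agree by (rule eventually_compose_filterlim[rotated])
    moreover have "\<forall>\<^sub>F t in at_right (0::real). t \<in> {0<..<1}"
      by (rule eventually_at_right_real) simp
    ultimately have "\<forall>\<^sub>F t in at_right (0::real).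
        Q ((1 - t) *\<^sub>R x + t *\<^sub>R u) = P ((1 - t) *\<^sub>R x + t *\<^sub>R u) \<and> t \<in> {0<..<1}"
      by (rule eventually_conj)
    then obtain t :: real where t: "0 < t" "t < 1"
      and eq: "Q ((1 - t) *\<^sub>R x + t *\<^sub>R u) = P ((1 - t) *\<^sub>R x + t *\<^sub>R u)"
      using eventually_happens'[OF trivial_limit_at_right_real] by force
    let ?v = "(1 - t) *\<^sub>R x + t *\<^sub>R u"
    have "P ?v \<le> ereal (1 - t) * P x + ereal t * Q u"
      using Q t eq Qx unfolding econvex_def by (metis greaterThanLessThan_iff)
    also have "\<dots> \<le> ereal (1 - t) * P x + ereal t * P x"
      using le t by (intro add_mono ereal_mult_left_mono) auto
    also have "\<dots> = P x"
      using fin t by (cases "P x") (auto simp: algebra_simps)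
    finally have "P ?v \<le> P x" .
    moreover have "P x \<le> P w" for w
      using P argmin_iff[of x P] by simp
    ultimately have "?v \<in> argmin P"
      by (meson argmin_iff order_trans)
    then have "?v = x"
      using P by simp
    then have "t *\<^sub>R (u - x) = 0"
      by (simp add: algebra_simps)
    then show False
      using t that by simp
  qed
  then have "x \<in> argmin Q"
    by (metis argmin_iff less_imp_le order_refl)
  moreover have "u = x" if "u \<in> argmin Q" for u
    using that less[of u] by (force simp: argmin_iff not_less[symmetric])
  ultimately show ?thesis
    by blast
qed

section \<open>Cut models\<close>

text \<open>A real-valued form of \<open>linearization\<close>, so that \<open>convex_on\<close> and \<open>continuous_on\<close> apply to the cuts; the
  two agree only at base points \<open>b\<close> where \<open>f b\<close> is finite.\<close>

definition real_cut ::
  "(real ^ 'n \<Rightarrow> ereal) \<Rightarrow> (real ^ 'n \<Rightarrow> real ^ 'n) \<Rightarrow> real ^ 'n \<Rightarrow> real ^ 'n \<Rightarrow> real" where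
  "real_cut f f' b u = real_of_ereal (f b) + f' b \<bullet> (u - b)"

lemma linearization_eq_real_cut:
  "\<bar>f b\<bar> \<noteq> \<infinity> \<Longrightarrow> linearization f f' u b = ereal (real_cut f f' b u)"
  by (cases "f b") (auto simp: linearization_def real_cut_def)

lemma convex_on_real_cut: "convex_on UNIV (real_cut f f' b)"
  by (rule convex_onI) (simp_all add: real_cut_def algebra_simps)

lemma continuous_on_real_cut: "continuous_on UNIV (real_cut f f' b)"
  unfolding real_cut_def by (intro continuous_intros)

lemma cut_model_eq_real_cut:
  assumes "finite B" "B \<noteq> {}" "\<forall>b\<in>B. \<bar>f b\<bar> \<noteq> \<infinity>"
  shows "cut_model f f' h B = (\<lambda>u. ereal (Max ((\<lambda>b. real_cut f f' b u) ` B)) + h u)"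
proof
  fix u
  have "(\<lambda>b. linearization f f' u b) ` B = ereal ` (\<lambda>b. real_cut f f' b u) ` B"
    using assms(3) by (auto simp: linearization_eq_real_cut image_image)
  also have "Max \<dots> = ereal (Max ((\<lambda>b. real_cut f f' b u) ` B))"
    using assms(1,2) by (subst mono_Max_commute[of ereal]) (auto simp: mono_def)
  finally show "cut_model f f' h B u = ereal (Max ((\<lambda>b. real_cut f f' b u) ` B)) + h u"
    by (simp add: cut_model_def)
qed

lemma cut_model_in_Conv:
  assumes "finite B" "B \<noteq> {}" "\<forall>b\<in>B. \<bar>f b\<bar> \<noteq> \<infinity>" and "h \<in> Conv \<mu>"
  shows "cut_model f f' h B \<in> Conv \<mu>"
proof -
  note convex_on_Max[OF assms(1,2) convex_on_real_cut]
    and continuous_on_Max[OF assms(1,2) continuous_on_real_cut]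
  then have "(\<lambda>u. ereal (Max ((\<lambda>b. real_cut f f' b u) ` B)) + h u) \<in> Conv \<mu>"
    by (rule Conv_add_real[OF assms(4)])
  moreover have "cut_model f f' h B = (\<lambda>u. ereal (Max ((\<lambda>b. real_cut f f' b u) ` B)) + h u)"
    by (rule cut_model_eq_real_cut[OF assms(1-3)])
  ultimately show ?thesis
    by (simp only:)
qed

lemma cut_model_mono:
  assumes "finite B" "A \<subseteq> B" "A \<noteq> {}"
  shows "cut_model f f' h A u \<le> cut_model f f' h B u"
  unfolding cut_model_def using assms by (intro add_right_mono Max_mono) auto

lemma linearization_le_cut_model:
  assumes "finite B" "b \<in> B"
  shows "linearization f f' u b + h u \<le> cut_model f f' h B u"
  unfolding cut_model_def using assms by (intro add_right_mono Max_ge) auto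

lemma cut_model_le:
  assumes "finite B" "B \<noteq> {}" "\<And>b. b \<in> B \<Longrightarrow> f' b \<in> subdifferential f b"
  shows "cut_model f f' h B u \<le> f u + h u"
proof -
  have "linearization f f' u b \<le> f u" if "b \<in> B" for b
    using assms(3)[OF that] by (simp add: subdifferential_def linearization_def)
  then have "Max ((\<lambda>b. linearization f f' u b) ` B) \<le> f u"
    using assms(1,2) by simp
  then show ?thesis
    unfolding cut_model_def by (rule add_right_mono)
qed

lemma ereal_convex_combination_le:
  assumes "0 < \<tau>" "\<tau> < 1" "a \<le> c" "b \<le> c"
  shows "ereal \<tau> * a + ereal (1 - \<tau>) * b \<le> c"
proof -
  have "ereal \<tau> * a + ereal (1 - \<tau>) * b \<le> ereal \<tau> * c + ereal (1 - \<tau>) * c"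
    using assms by (intro add_mono ereal_mult_left_mono) auto
  also have "\<dots> = c"
    using assms(1,2) by (cases c) (auto simp: algebra_simps)
  finally show ?thesis .
qed

text \<open>Since \<open>h x\<close> is finite, it cancels in the definition of \<open>A\<close>, which therefore is the active set of the
  finite maximum.  The two models, and with them the two proximal objectives, then agree near \<open>x\<close>, and
  convexity turns this local agreement into equality of the minimizers.\<close>

lemma cut_model_active_prox:
  assumes "0 \<le> \<mu>" "0 < lam" and h: "h \<in> Conv \<mu>"
    and B: "finite B" "B \<noteq> {}" "\<forall>b\<in>B. \<bar>f b\<bar> \<noteq> \<infinity>"
    and hx: "\<bar>h x\<bar> \<noteq> \<infinity>"
    and min: "argmin (prox_objective lam xc (cut_model f f' h B)) = {x}"
    and A: "A = {b \<in> B. linearization f f' x b + h x = cut_model f f' h B x}"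
  shows "A \<noteq> {}" "cut_model f f' h A x = cut_model f f' h B x"
    "argmin (prox_objective lam xc (cut_model f f' h A)) = {x}"
proof -
  let ?l = "real_cut f f'"
  have A': "A = {b \<in> B. ?l b x = Max ((\<lambda>b. ?l b x) ` B)}"
  proof -
    have eq: "cut_model f f' h B x = ereal (Max ((\<lambda>b. ?l b x) ` B)) + h x"
      using cut_model_eq_real_cut[OF B] by (rule fun_cong)
    have "(linearization f f' x b + h x = cut_model f f' h B x) \<longleftrightarrow>
        ?l b x = Max ((\<lambda>b. ?l b x) ` B)" if "b \<in> B" for b
      using hx bspec[OF B(3) that]
      unfolding eq by (cases "h x") (simp_all add: linearization_eq_real_cut)
    then show ?thesis
      unfolding A by blast
  qed
  have "Max ((\<lambda>b. ?l b x) ` B) \<in> (\<lambda>b. ?l b x) ` B"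
    using B by simp
  then show ne: "A \<noteq> {}"
    unfolding A' by auto
  have A_fin: "finite A" "\<forall>b\<in>A. \<bar>f b\<bar> \<noteq> \<infinity>"
    using B A by auto
  have "\<forall>\<^sub>F u in nhds x. Max ((\<lambda>b. ?l b u) ` A) = Max ((\<lambda>b. ?l b u) ` B)"
    by (rule eventually_Max_active[OF B(1,2) continuous_on_real_cut A'])
  then have agree: "\<forall>\<^sub>F u in nhds x. cut_model f f' h A u = cut_model f f' h B u"
    unfolding cut_model_eq_real_cut[OF B] cut_model_eq_real_cut[OF A_fin(1) ne A_fin(2)]
    by eventually_elim simp
  then show "cut_model f f' h A x = cut_model f f' h B x"
    by (rule eventually_nhds_x_imp_x)
  have conv: "econvex (prox_objective lam xc (cut_model f f' h A))"
    by (rule econvex_prox_objective[OF assms(1,2) cut_model_in_Conv[OF A_fin(1) ne A_fin(2) h]])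
  have fin: "\<bar>prox_objective lam xc (cut_model f f' h B) x\<bar> \<noteq> \<infinity>"
    using hx unfolding prox_objective_def cut_model_eq_real_cut[OF B] by (cases "h x") auto
  have "\<forall>\<^sub>F u in nhds x. prox_objective lam xc (cut_model f f' h A) u =
      prox_objective lam xc (cut_model f f' h B) u"
    using agree by eventually_elim (simp add: prox_objective_def)
  then show "argmin (prox_objective lam xc (cut_model f f' h A)) = {x}"
    by (rule argmin_eq_of_local_agreement[OF min fin conv])
qed

section \<open>The multiple-cuts update\<close>

theorem propositionD2:
  fixes f h \<phi> \<Gamma> \<Gamma>p \<Gamma>b :: "real ^ 'n \<Rightarrow> ereal"
    and f' :: "real ^ 'n \<Rightarrow> real ^ 'n"
    and \<mu> lam \<tau> :: real
    and xc x :: "real ^ 'n"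
    and B Bx Bp :: "(real ^ 'n) set"
  assumes "0 \<le> \<mu>"
    and "proper f" and "lsc f" and "econvex f"
    and "h \<in> Conv \<mu>"
    and "edom h \<subseteq> edom f"
    and "\<phi> = (\<lambda>u. f u + h u)"
    and "\<forall>z \<in> edom h. f' z \<in> subdifferential f z"
    and "0 < lam"
    and "B \<noteq> {}" and "finite B" and "B \<subseteq> edom h"
    and "\<Gamma> = cut_model f f' h B"
    and "argmin (prox_objective lam xc \<Gamma>) = {x}"
    and "Bx = {b \<in> B. linearization f f' x b + h x = \<Gamma> x}"
    and "Bx \<union> {x} \<subseteq> Bp" and "Bp \<subseteq> B \<union> {x}"
    and "\<Gamma>p = cut_model f f' h Bp"
    and "\<Gamma>b = cut_model f f' h Bx"
    and "0 < \<tau>" and "\<tau> < 1"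
  shows "\<Gamma>p \<in> Conv \<mu> \<and>
    (\<forall>u. ereal \<tau> * \<Gamma>b u + ereal (1 - \<tau>) * (linearization f f' u x + h u) \<le> \<Gamma>p u \<and>
         \<Gamma>p u \<le> \<phi> u) \<and>
    \<Gamma>b \<in> Conv \<mu> \<and>
    \<Gamma>b x = \<Gamma> x \<and>
    argmin (prox_objective lam xc \<Gamma>b) = {x} \<and>
    BU_input \<mu> f h lam \<tau> xc x \<Gamma> \<and>
    BU_output \<mu> f f' h lam \<tau> xc x \<Gamma> \<Gamma>p"
proof -
  note h = \<open>h \<in> Conv \<mu>\<close> and \<Gamma> = \<open>\<Gamma> = cut_model f f' h B\<close>
    and \<tau> = \<open>0 < \<tau>\<close> \<open>\<tau> < 1\<close>
    and min = \<open>argmin (prox_objective lam xc \<Gamma>) = {x}\<close>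
  have hproper: "proper h"
    using h by (simp add: Conv_def)
  have f_fin: "\<forall>b\<in>S. \<bar>f b\<bar> \<noteq> \<infinity>" if "S \<subseteq> edom h" for S
  proof
    fix b
    assume "b \<in> S"
    then have "b \<in> edom f"
      using that assms(6) by blast
    then show "\<bar>f b\<bar> \<noteq> \<infinity>"
      using assms(2) by (cases "f b") (auto simp: proper_def edom_def)
  qed
  have subgrad: "f' b \<in> subdifferential f b" if "b \<in> edom h" for b
    using that assms(8) by blast
  have B: "finite B" "B \<noteq> {}" "\<forall>b\<in>B. \<bar>f b\<bar> \<noteq> \<infinity>"
    by (rule \<open>finite B\<close> \<open>B \<noteq> {}\<close>)+ (rule f_fin[OF \<open>B \<subseteq> edom h\<close>])
  \<comment> \<open>The points of \<open>B\<close> have finite objective values, so the minimal value is below \<open>\<infinity>\<close>.\<close>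
  have x_dom: "x \<in> edom h"
  proof -
    obtain b where b: "b \<in> B" "b \<in> edom h"
      using assms(10,12) by blast
    have "prox_objective lam xc \<Gamma> x \<le> prox_objective lam xc \<Gamma> b"
      using min argmin_iff[of x "prox_objective lam xc \<Gamma>"] by auto
    also have "\<dots> < \<infinity>"
      using b(2) by (cases "h b") (auto simp: prox_objective_def \<Gamma> cut_model_eq_real_cut[OF B] edom_def)
    finally show ?thesis
      by (cases "h x") (auto simp: prox_objective_def \<Gamma> cut_model_eq_real_cut[OF B] edom_def)
  qed
  then have hx: "\<bar>h x\<bar> \<noteq> \<infinity>"
    using hproper by (cases "h x") (auto simp: proper_def edom_def)
  have Bx_def: "Bx = {b \<in> B. linearization f f' x b + h x = cut_model f f' h B x}"
    using assms(15) \<Gamma> by simp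
  note active = cut_model_active_prox[OF assms(1,9) h B hx min[unfolded \<Gamma>] Bx_def]
  have Bx: "finite Bx" "Bx \<subseteq> edom h"
    using B(1) assms(12) unfolding Bx_def by auto
  have Bp: "finite Bp" "Bp \<noteq> {}" "Bp \<subseteq> edom h" "x \<in> Bp" "Bx \<subseteq> Bp"
    using assms(16,17) B(1) assms(12) x_dom by (auto intro: finite_subset[of Bp "B \<union> {x}"])
  have \<Gamma>_Conv: "\<Gamma> \<in> Conv \<mu>"
    unfolding \<Gamma> by (rule cut_model_in_Conv[OF B h])
  have \<Gamma>p_Conv: "\<Gamma>p \<in> Conv \<mu>"
    unfolding \<open>\<Gamma>p = cut_model f f' h Bp\<close>
    by (rule cut_model_in_Conv[OF Bp(1,2) f_fin[OF Bp(3)] h])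
  have \<Gamma>b_Conv: "\<Gamma>b \<in> Conv \<mu>"
    unfolding \<open>\<Gamma>b = cut_model f f' h Bx\<close>
    by (rule cut_model_in_Conv[OF Bx(1) active(1) f_fin[OF Bx(2)] h])
  have \<Gamma>_le: "\<Gamma> u \<le> f u + h u" for u
    unfolding \<Gamma> by (rule cut_model_le[OF B(1,2) subgrad[OF subsetD[OF assms(12)]]])
  have \<Gamma>p_le: "\<Gamma>p u \<le> f u + h u" for u
    unfolding \<open>\<Gamma>p = cut_model f f' h Bp\<close>
    by (rule cut_model_le[OF Bp(1,2) subgrad[OF subsetD[OF Bp(3)]]])
  have lower: "ereal \<tau> * \<Gamma>b u + ereal (1 - \<tau>) * (linearization f f' u x + h u) \<le> \<Gamma>p u" for u
    unfolding \<open>\<Gamma>p = cut_model f f' h Bp\<close> \<open>\<Gamma>b = cut_model f f' h Bx\<close>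
    by (rule ereal_convex_combination_le[OF \<tau> cut_model_mono[OF Bp(1,5) active(1)]
          linearization_le_cut_model[OF Bp(1,4)]])
  have \<Gamma>b_x: "\<Gamma>b x = \<Gamma> x" and \<Gamma>b_min: "argmin (prox_objective lam xc \<Gamma>b) = {x}"
    using active(2,3) \<Gamma> \<open>\<Gamma>b = cut_model f f' h Bx\<close> by auto
  have "BU_input \<mu> f h lam \<tau> xc x \<Gamma>"
    using assms(9) \<tau> \<Gamma>_Conv \<Gamma>_le min by (simp add: BU_input_def)
  moreover have "BU_output \<mu> f f' h lam \<tau> xc x \<Gamma> \<Gamma>p"
    unfolding BU_output_def
    by (intro conjI bexI[of _ \<Gamma>b] allI x_dom \<Gamma>p_Conv \<Gamma>b_Conv \<Gamma>b_x \<Gamma>b_min lower \<Gamma>p_le)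
  ultimately show ?thesis
    unfolding \<open>\<phi> = (\<lambda>u. f u + h u)\<close>
    by (intro conjI allI \<Gamma>p_Conv lower \<Gamma>p_le \<Gamma>b_Conv \<Gamma>b_x \<Gamma>b_min)
qed

end
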